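(* Let $\mu_k$, $-p\leq k\leq q$, be a collection of $p+q+1$ arbitrary Borel probability measures with compact support in $\mathbb{C}$. For each $-p\leq k\leq q$, let $a^{(k)}=(a^{(k)}_n)_{n\in\mathbb{Z}}$ be a sequence of i.i.d. random variables with distribution $\mu_k$. Assume also that the whole collection $\{a^{(k)}_n: n\in\mathbb{Z},\,-p\leq k\leq q\}$ is jointly independent and that the $a^{(k)}_n$ are surely bounded in modulus by an absolute constant. Then for each nonnegative integer $\ell$, $$\lim_{n\rightarrow\infty}\mathbb{E}\left(\int z^{\ell}\,d\sigma_n(z)\right)=\lim_{n\rightarrow\infty}\mathbb{E}\left(\frac{1}{n}\sum_{i=1}^{n}\lambda_{i,n}^{\ell}\right)=\mathbb{E}(W_{[\ell,0,0]}).$$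
   Context: Fix integers $p,q\geq 1$. For $n\geq 1$, $H_n=(h_{i,j})_{i,j=0}^{n-1}$ is the random $n\times n$ banded matrix with $h_{i,j}=a^{(j-i)}_{\min(i,j)}$ if $-p\leq j-i\leq q$ and $h_{i,j}=0$ otherwise. $\{\lambda_{i,n}\}_{i=1}^n$ are the eigenvalues of $H_n$ counted with (algebraic) multiplicity, and $\sigma_n=\frac1n\sum_{i=1}^n\delta_{\lambda_{i,n}}$ is the empirical measure of $H_n$. $W_{[\ell,0,0]}$ is the (random) weight polynomial $\sum_{\gamma\in\mathcal{P}_{[\ell,0,0]}}w(\gamma)$, where $\mathcal{P}_{[\ell,0,0]}$ is the collection of all lattice paths of length $\ell$ (sequences of $\ell$ consecutive steps) with initial point $(0,0)$ and final point $(\ell,0)$, with vertices in $\mathbb{Z}_{\geq 0}\times\mathbb{Z}$. The allowed steps are $(n,m)\rightarrow(n+1,m+i)$ with $0\leq i\leq q$, of weight $a_m^{(i)}$, and $(n,m)\rightarrow(n+1,m-j)$ with $1\leq j\leq p$, of weight $a_{m-j}^{(-j)}$. The weight $w(\gamma)$ of a path is the product of the weights of its steps ($1$ for the path of length zero), and an empty sum is zero. *)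

theory Defs
  imports
    "HOL-Probability.Probability"
    "Jordan_Normal_Form.Char_Poly"
begin

text \<open>
  Throughout, a family of coefficients is a function \<open>a\<close>, where \<open>a k m\<close> is the \<open>m\<close>-th term
  of the sequence belonging to the \<open>k\<close>-th diagonal; only \<open>- p \<le> k \<le> q\<close> is relevant.
\<close>

definition banded_matrix ::
    "nat \<Rightarrow> nat \<Rightarrow> (int \<Rightarrow> int \<Rightarrow> complex) \<Rightarrow> nat \<Rightarrow> complex Matrix.mat" where
  "banded_matrix p q a n =
     Matrix.mat n n (\<lambda>(i, j).
       if - int p \<le> int j - int i \<and> int j - int i \<le> int q
       then a (int j - int i) (int (min i j)) else 0)"

text \<open>Eigenvalues repeated according to their algebraic multiplicity.\<close>

definition eigenvalue_mset :: "complex Matrix.mat \<Rightarrow> complex multiset" where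
  "eigenvalue_mset A = proots (char_poly A)"

definition empirical_measure :: "complex Matrix.mat \<Rightarrow> complex measure" where
  "empirical_measure A =
     measure_of UNIV (sets borel)
       (\<lambda>X. ennreal (1 / real (dim_row A)) *
            (\<Sum>x\<in>#eigenvalue_mset A. emeasure (return borel x) X))"

text \<open>
  A path is the list of its vertices, so a path of length \<open>l\<close> is a list of \<open>l + 1\<close> vertices.
  Between two given vertices there is at most one step.
\<close>

definition path_step :: "nat \<Rightarrow> nat \<Rightarrow> nat \<times> int \<Rightarrow> nat \<times> int \<Rightarrow> bool" where
  "path_step p q u v \<longleftrightarrow>
     fst v = fst u + 1 \<and>
     ((\<exists>i. i \<le> q \<and> snd v = snd u + int i) \<or>
      (\<exists>j. 1 \<le> j \<and> j \<le> p \<and> snd v = snd u - int j))"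

text \<open>
  A step up (or level) by \<open>i\<close> from height \<open>m\<close> has weight \<open>a i m\<close>, and a step down by \<open>j\<close>
  from height \<open>m\<close> has weight \<open>a (- j) (m - j)\<close>, indexed by the height at which it ends.
\<close>

definition step_weight :: "(int \<Rightarrow> int \<Rightarrow> complex) \<Rightarrow> nat \<times> int \<Rightarrow> nat \<times> int \<Rightarrow> complex" where
  "step_weight a u v =
     (if snd u \<le> snd v then a (snd v - snd u) (snd u) else a (snd v - snd u) (snd v))"

definition lattice_paths ::
    "nat \<Rightarrow> nat \<Rightarrow> nat \<Rightarrow> nat \<times> int \<Rightarrow> nat \<times> int \<Rightarrow> (nat \<times> int) list set" where
  "lattice_paths p q l u v =
     {\<gamma>. length \<gamma> = l + 1 \<and> hd \<gamma> = u \<and> last \<gamma> = v \<and>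
         (\<forall>t<l. path_step p q (\<gamma> ! t) (\<gamma> ! (t + 1)))}"

definition path_weight :: "(int \<Rightarrow> int \<Rightarrow> complex) \<Rightarrow> (nat \<times> int) list \<Rightarrow> complex" where
  "path_weight a \<gamma> = (\<Prod>t<length \<gamma> - 1. step_weight a (\<gamma> ! t) (\<gamma> ! (t + 1)))"

text \<open>The weight polynomial of the paths of length \<open>l\<close> from \<open>(0, 0)\<close> to \<open>(l, 0)\<close>.\<close>

definition weight_poly :: "nat \<Rightarrow> nat \<Rightarrow> (int \<Rightarrow> int \<Rightarrow> complex) \<Rightarrow> nat \<Rightarrow> complex" where
  "weight_poly p q a l = (\<Sum>\<gamma>\<in>lattice_paths p q l (0, 0) (l, 0). path_weight a \<gamma>)"

definition measure_support :: "'a::topological_space measure \<Rightarrow> 'a set" where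
  "measure_support M = {x. \<forall>U. open U \<and> x \<in> U \<longrightarrow> emeasure M U > 0}"

end

theory Submission
  imports Defs "Jordan_Normal_Form.Schur_Decomposition"
begin

text \<open>
  Both averages equal the normalised trace of the \<open>l\<close>-th power of the banded matrix. A diagonal
  entry of that power is the total weight of the closed walks of length \<open>l\<close> at height \<open>i\<close> that stay
  in \<open>{0..<n}\<close>. When \<open>p * l \<le> i < n - q * l\<close> no walk can leave this range, so the entry is a
  translate of the weight polynomial and, the coefficients being i.i.d. along each diagonal and
  jointly independent, it has the same expectation. The remaining boundary entries are bounded in
  number and in modulus, hence negligible after division by \<open>n\<close>.
\<close>

subsection \<open>Power sums of eigenvalues\<close>

text \<open>\<open>pow_mat\<close> unfolds with the new factor on the right, whereas
  \<open>walk_sum\<close> peels off the first step of a walk, which is the leftmost factor.\<close>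

lemma pow_mat_Suc_left:
  assumes "A \<in> carrier_mat n n"
  shows "A ^\<^sub>m Suc k = A * A ^\<^sub>m k"
proof (induction k)
  case 0
  then show ?case using assms by simp
next
  case (Suc k)
  have "A ^\<^sub>m Suc (Suc k) = (A * A ^\<^sub>m k) * A" using Suc by simp
  also have "\<dots> = A * (A ^\<^sub>m k * A)"
    using assms by (intro assoc_mult_mat[of _ n n _ n _ n]) auto
  finally show ?case by simp
qed

lemma index_mult_mat_sum:
  assumes "A \<in> carrier_mat n m" "B \<in> carrier_mat m k" "i < n" "j < k"
  shows "(A * B) $$ (i, j) = (\<Sum>r<m. A $$ (i, r) * B $$ (r, j))"
  using assms by (simp add: scalar_prod_def atLeast0LessThan)

text \<open>The two claims go through one induction: in a diagonal entry of
  \<open>B ^\<^sub>m k * B\<close> the summand for \<open>r < i\<close> dies by triangularity of the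
  power and that for \<open>r > i\<close> by triangularity of \<open>B\<close>.\<close>

lemma upper_triangular_pow:
  fixes B :: "'a :: comm_semiring_1 Matrix.mat"
  assumes B: "B \<in> carrier_mat n n" and ut: "upper_triangular B"
  shows "upper_triangular (B ^\<^sub>m k) \<and> (\<forall>i<n. (B ^\<^sub>m k) $$ (i, i) = (B $$ (i, i)) ^ k)"
proof (induction k)
  case 0
  then show ?case using B by auto
next
  case (Suc k)
  have Bk: "B ^\<^sub>m k \<in> carrier_mat n n" using B by simp
  have entry: "(B ^\<^sub>m Suc k) $$ (i, j) = (\<Sum>r<n. (B ^\<^sub>m k) $$ (i, r) * B $$ (r, j))"
    if "i < n" "j < n" for i j
    using index_mult_mat_sum[OF Bk B that] by simp
  have z1: "(B ^\<^sub>m k) $$ (i, j) = 0" if "j < i" "i < n" for i j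
    using Suc Bk that upper_triangularD[of "B ^\<^sub>m k" j i] by auto
  have z2: "B $$ (i, j) = 0" if "j < i" "i < n" for i j
    using ut B that by auto
  have "(B ^\<^sub>m Suc k) $$ (i, j) = 0" if "j < i" "i < n" for i j
  proof -
    have "(B ^\<^sub>m k) $$ (i, r) * B $$ (r, j) = 0" if "r < n" for r
      using z1[of r i] z2[of j r] \<open>j < i\<close> \<open>i < n\<close> that by (cases "r < i") auto
    then show ?thesis using that by (simp add: entry del: pow_mat.simps)
  qed
  then have "upper_triangular (B ^\<^sub>m Suc k)" using B by (auto simp del: pow_mat.simps)
  moreover have "(B ^\<^sub>m Suc k) $$ (i, i) = (B $$ (i, i)) ^ Suc k" if "i < n" for i
  proof -
    have "(\<Sum>r<n. (B ^\<^sub>m k) $$ (i, r) * B $$ (r, i)) =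
        (\<Sum>r<n. if r = i then (B $$ (i, i)) ^ Suc k else 0)"
      using z1 z2 Suc that by (intro sum.cong refl) (auto simp: neq_iff mult.commute)
    then show ?thesis using that by (simp add: entry del: pow_mat.simps)
  qed
  ultimately show ?case by blast
qed

lemma sum_diag_mult_commute:
  fixes A B :: "'a :: comm_semiring_0 Matrix.mat"
  assumes "A \<in> carrier_mat n m" "B \<in> carrier_mat m n"
  shows "(\<Sum>i<n. (A * B) $$ (i, i)) = (\<Sum>i<m. (B * A) $$ (i, i))"
proof -
  have "(\<Sum>i<n. (A * B) $$ (i, i)) = (\<Sum>i<n. \<Sum>r<m. A $$ (i, r) * B $$ (r, i))"
    by (rule sum.cong[OF refl]) (rule index_mult_mat_sum[OF assms], auto)
  also have "\<dots> = (\<Sum>r<m. \<Sum>i<n. B $$ (r, i) * A $$ (i, r))"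
    by (subst sum.swap) (simp add: mult.commute)
  also have "\<dots> = (\<Sum>r<m. (B * A) $$ (r, r))"
    by (rule sum.cong[OF refl], rule index_mult_mat_sum[symmetric, OF assms(2,1)]) auto
  finally show ?thesis .
qed

text \<open>Schur triangularisation puts the eigenvalues on the diagonal of \<open>B\<close>, where
  powers act entrywise, and the trace does not see the change of basis.\<close>

lemma sum_eigenvalue_powers:
  assumes A: "A \<in> carrier_mat n n"
  shows "(\<Sum>x\<in>#eigenvalue_mset A. x ^ l) = (\<Sum>i<n. (A ^\<^sub>m l) $$ (i, i))"
proof -
  obtain es where es: "char_poly A = (\<Prod>a\<leftarrow>es. [:- a, 1:])" "length es = n"
    using char_poly_factorized[OF A] by blast
  obtain B P Q where BPQ: "schur_decomposition A es = (B, P, Q)"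
    by (metis prod_cases3)
  from schur_decomposition[OF A es(1) BPQ]
  have w: "similar_mat_wit A B P Q" and ut: "upper_triangular B" and dg: "diag_mat B = es"
    by auto
  note D' = similar_mat_witD2[OF A w]
  have Al: "A ^\<^sub>m l \<in> carrier_mat n n" using A by simp
  note D = similar_mat_witD2[OF Al similar_mat_wit_pow[OF w, of l]]
  \<comment> \<open>Links the algebraic multiplicities in \<open>eigenvalue_mset\<close> with the
    list that Schur decomposition places on the diagonal.\<close>
  have "proots (char_poly A) = mset es"
    unfolding es(1)
  proof (induction es)
    case (Cons e es)
    have "(\<Prod>a\<leftarrow>es. [:- a, 1:]) \<noteq> (0 :: complex poly)" by (auto simp: prod_list_zero_iff)
    then have "proots ([:- e, 1:] * (\<Prod>a\<leftarrow>es. [:- a, 1:])) = {#e#} + mset es"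
      using Cons by (subst proots_mult) auto
    then show ?case by (simp del: mult_pCons_left)
  qed simp
  then have "(\<Sum>x\<in>#eigenvalue_mset A. x ^ l) = (\<Sum>x\<leftarrow>es. x ^ l)"
    by (simp add: eigenvalue_mset_def flip: sum_mset_sum_list)
  also have "\<dots> = (\<Sum>i<n. (B $$ (i, i)) ^ l)"
    using D'(5) by (simp flip: dg add: diag_mat_def o_def atLeast0LessThan
        interv_sum_list_conv_sum_set_nat)
  also have "\<dots> = (\<Sum>i<n. (B ^\<^sub>m l) $$ (i, i))"
    using upper_triangular_pow[OF D'(5) ut, of l] by simp
  \<comment> \<open>Inserting \<open>Q * P = 1\<close> prepares for cyclicity of the trace, which
    moves \<open>Q\<close> to the right end and so restores the power of \<open>A\<close>.\<close>
  also have "\<dots> = (\<Sum>i<n. ((Q * P) * B ^\<^sub>m l) $$ (i, i))"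
    unfolding D(2) left_mult_one_mat[OF D(5)] ..
  also have "\<dots> = (\<Sum>i<n. (Q * (P * B ^\<^sub>m l)) $$ (i, i))"
    using D by (subst assoc_mult_mat[of _ n n _ n _ n]) auto
  also have "\<dots> = (\<Sum>i<n. ((P * B ^\<^sub>m l) * Q) $$ (i, i))"
    using D by (intro sum_diag_mult_commute) auto
  also have "\<dots> = (\<Sum>i<n. (A ^\<^sub>m l) $$ (i, i))"
    using D by simp
  finally show ?thesis .
qed

section \<open>Integration against the empirical measure\<close>

lemma size_eigenvalue_mset:
  assumes "A \<in> carrier_mat n n"
  shows "size (eigenvalue_mset A) = n"
  using degree_monic_char_poly[OF assms] by (simp add: eigenvalue_mset_def size_proots_complex)

lemma sum_mset_eq_sum_count:
  fixes f :: "'a \<Rightarrow> 'b :: comm_semiring_1"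
  shows "(\<Sum>x\<in>#E. f x) = (\<Sum>x\<in>set_mset E. of_nat (count E x) * f x)"
proof (induction E)
  case (add y E)
  have "(\<Sum>x\<in>set_mset (add_mset y E). of_nat (count (add_mset y E) x) * f x) =
      (\<Sum>x\<in>insert y (set_mset E). of_nat (count E x) * f x + (if x = y then f y else 0))"
    by (intro sum.cong) (auto simp: algebra_simps)
  also have "\<dots> = (\<Sum>x\<in>insert y (set_mset E). of_nat (count E x) * f x) + f y"
    by (simp add: sum.distrib)
  \<comment> \<open>If \<open>y\<close> is new, its count in \<open>E\<close> is 0, so the enlarged
    index set adds nothing.\<close>
  also have "(\<Sum>x\<in>insert y (set_mset E). of_nat (count E x) * f x) = (\<Sum>x\<in>set_mset E. of_nat (count E x) * f x)"
    by (rule sum.mono_neutral_right) (auto simp: not_in_iff)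
  finally show ?case using add by (simp add: add.commute)
qed simp

text \<open>Writing the measure as the image of a finite pmf supplies countable additivity, on which
  the values of \<open>measure_of\<close> depend. Positivity of \<open>n\<close> makes the multiset
  nonempty, so that the pmf has the expected weights.\<close>

lemma empirical_measure_eq_pmf:
  assumes A: "A \<in> carrier_mat n n" and n: "n > 0"
  shows "empirical_measure A = distr (measure_pmf (pmf_of_multiset (eigenvalue_mset A))) borel (\<lambda>x. x)"
    (is "_ = ?N")
proof -
  let ?E = "eigenvalue_mset A"
  have sz: "size ?E = n" by (rule size_eigenvalue_mset[OF A])
  then have ne: "?E \<noteq> {#}" using n by auto
  have em: "emeasure ?N X = ennreal (1 / real (dim_row A)) *
            (\<Sum>x\<in>#?E. emeasure (return borel x) X)" if X: "X \<in> sets borel" for X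
  proof -
    have "emeasure ?N X = emeasure (measure_pmf (pmf_of_multiset ?E)) (X \<inter> set_pmf (pmf_of_multiset ?E))"
      using X by (subst emeasure_distr) (auto simp: emeasure_Int_set_pmf)
    also have "\<dots> = (\<Sum>x\<in>X \<inter> set_mset ?E. ennreal (real (count ?E x) / real n))"
      using ne sz by (subst emeasure_measure_pmf_finite) auto
    also have "\<dots> = (\<Sum>x\<in>set_mset ?E. ennreal (1 / real n) * (of_nat (count ?E x) * indicator X x))"
      by (rule sum.mono_neutral_cong_left)
         (auto simp: indicator_def divide_inverse mult.commute ennreal_of_nat_eq_real_of_nat
           simp flip: ennreal_mult)
    also have "\<dots> = ennreal (1 / real (dim_row A)) * (\<Sum>x\<in>#?E. emeasure (return borel x) X)"
      using A X by (simp add: sum_mset_eq_sum_count flip: sum_distrib_left)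
    finally show ?thesis .
  qed
  have "?N = measure_of UNIV (sets borel) (emeasure ?N)"
    using measure_of_of_measure[of ?N] by simp
  \<comment> \<open>\<open>measure_of\<close> depends only on the values on the sigma-algebra, so
    agreement on Borel sets suffices.\<close>
  also have "\<dots> = empirical_measure A"
    unfolding empirical_measure_def
    by (rule measure_of_eq) (auto simp: em sets.sigma_sets_eq[of borel, simplified])
  finally show ?thesis by simp
qed

lemma integral_empirical_measure:
  fixes f :: "complex \<Rightarrow> complex"
  assumes A: "A \<in> carrier_mat n n" and n: "n > 0" and f: "f \<in> borel_measurable borel"
  shows "(LINT z|empirical_measure A. f z) = 1 / of_nat n * (\<Sum>x\<in>#eigenvalue_mset A. f x)"
proof -
  let ?E = "eigenvalue_mset A"
  have sz: "size ?E = n" by (rule size_eigenvalue_mset[OF A])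
  then have ne: "?E \<noteq> {#}" using n by auto
  have "(LINT z|empirical_measure A. f z) = measure_pmf.expectation (pmf_of_multiset ?E) f"
    unfolding empirical_measure_eq_pmf[OF A n] using f by (subst integral_distr) auto
  also have "\<dots> = (\<Sum>x\<in>set_mset ?E. (real (count ?E x) / real n) *\<^sub>R f x)"
    using ne sz by (subst integral_measure_pmf[of "set_mset ?E"]) auto
  also have "\<dots> = 1 / of_nat n * (\<Sum>x\<in>#?E. f x)"
    by (simp add: sum_mset_eq_sum_count sum_distrib_left scaleR_conv_of_real)
  finally show ?thesis .
qed

subsection \<open>Walks\<close>

text \<open>Only the vertices after the first are confined to \<open>S\<close>; the starting height \<open>i\<close> may lie outside it.\<close>

primrec walk_sum ::
    "nat \<Rightarrow> nat \<Rightarrow> (int \<Rightarrow> int \<Rightarrow> complex) \<Rightarrow> int set \<Rightarrow> nat \<Rightarrow> int \<Rightarrow> int \<Rightarrow> complex" where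
  "walk_sum p q a S 0 i j = (if i = j then 1 else 0)"
| "walk_sum p q a S (Suc l) i j =
     (\<Sum>k\<in>{i - int p..i + int q} \<inter> S. a (k - i) (min i k) * walk_sum p q a S l k j)"

lemma walk_sum_cong:
  assumes "\<And>k m. k \<in> {- int p..int q} \<Longrightarrow> a k m = b k m"
  shows "walk_sum p q a S l i j = walk_sum p q b S l i j"
  by (induction l arbitrary: i) (auto intro!: sum.cong simp: assms)

text \<open>With \<open>S = UNIV\<close> the admissible heights are translation invariant, so a
  change of starting height can be traded for a shift of the coefficient sequences.\<close>

lemma walk_sum_shift:
  "walk_sum p q (\<lambda>k m. a k (m + s)) UNIV l i j = walk_sum p q a UNIV l (i + s) (j + s)"
proof (induction l arbitrary: i)
  case (Suc l)
  have "(\<Sum>k\<in>{i + s - int p..i + s + int q}. a (k - (i + s)) (min (i + s) k) *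
          walk_sum p q a UNIV l k (j + s)) =
        (\<Sum>k\<in>{i - int p..i + int q}. a (k - i) (min (i + s) (k + s)) *
          walk_sum p q a UNIV l (k + s) (j + s))"
    by (rule sum.reindex_bij_witness[of _ "\<lambda>k. k + s" "\<lambda>k. k - s"])
       (auto simp: algebra_simps)
  then show ?case by (simp add: Suc min_add_distrib_left)
qed simp

text \<open>In \<open>l\<close> steps a walk descends by at most \<open>p * l\<close> and climbs by
  at most \<open>q * l\<close>, so the confinement to \<open>S\<close> is vacuous.\<close>

lemma walk_sum_interior:
  assumes "{i - int (p * l)..i + int (q * l)} \<subseteq> S"
  shows "walk_sum p q a S l i j = walk_sum p q a UNIV l i j"
  using assms
proof (induction l arbitrary: i)
  case (Suc l)
  have sub: "{k - int (p * l)..k + int (q * l)} \<subseteq> S" if "k \<in> {i - int p..i + int q}" for k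
    by (rule subset_trans[OF _ Suc.prems]) (use that in auto)
  have "{i - int p..i + int q} \<subseteq> S"
  proof
    fix k assume "k \<in> {i - int p..i + int q}"
    from sub[OF this] show "k \<in> S" by (rule subsetD) auto
  qed
  then have "{i - int p..i + int q} \<inter> S = {i - int p..i + int q}" by blast
  then show ?case using Suc.IH[OF sub] by simp
qed simp

text \<open>Each step has at most \<open>p + q + 1\<close> targets and weight at most
  \<open>C\<close>. The bound is uniform in \<open>S\<close>, \<open>i\<close> and
  \<open>j\<close>.\<close>

lemma norm_walk_sum_le:
  assumes C: "\<And>k m. k \<in> {- int p..int q} \<Longrightarrow> norm (a k m) \<le> C" and "C \<ge> 0"
  shows "norm (walk_sum p q a S l i j) \<le> (real (p + q + 1) * C) ^ l"
proof (induction l arbitrary: i)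
  case (Suc l)
  let ?K = "{i - int p..i + int q} \<inter> S"
  have "norm (walk_sum p q a S (Suc l) i j) \<le>
      (\<Sum>k\<in>?K. norm (a (k - i) (min i k) * walk_sum p q a S l k j))"
    by (simp add: norm_sum)
  also have "\<dots> \<le> (\<Sum>k\<in>?K. C * (real (p + q + 1) * C) ^ l)"
    using Suc assms by (intro sum_mono) (auto simp: norm_mult intro!: mult_mono)
  also have "\<dots> = real (card ?K) * (C * (real (p + q + 1) * C) ^ l)"
    by simp
  also have "\<dots> \<le> real (p + q + 1) * (C * (real (p + q + 1) * C) ^ l)"
  proof (rule mult_right_mono)
    have "card ?K \<le> card {i - int p..i + int q}" by (rule card_mono) auto
    then show "real (card ?K) \<le> real (p + q + 1)" by simp
  qed (use \<open>C \<ge> 0\<close> in auto)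
  finally show ?case by (simp add: mult_ac)
qed simp

text \<open>Needed on two spaces: for the random coefficients on \<open>M\<close>, and for the
  coordinate functions on the product space of all coefficients.\<close>

lemma walk_sum_measurable:
  assumes "\<And>k m. k \<in> {- int p..int q} \<Longrightarrow> (\<lambda>\<omega>. a k m \<omega>) \<in> borel_measurable M"
  shows "(\<lambda>\<omega>. walk_sum p q (\<lambda>k m. a k m \<omega>) S l i j) \<in> borel_measurable M"
proof (induction l arbitrary: i)
  case (Suc l)
  show ?case unfolding walk_sum.simps
    by (intro borel_measurable_sum borel_measurable_times Suc assms) auto
qed simp

section \<open>The weight polynomial as an unconfined walk sum\<close>

lemma path_step_iff:
  "path_step p q u v \<longleftrightarrow> fst v = fst u + 1 \<and> snd v \<in> {snd u - int p..snd u + int q}"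
proof
  assume *: "fst v = fst u + 1 \<and> snd v \<in> {snd u - int p..snd u + int q}"
  show "path_step p q u v"
  proof (cases "snd u \<le> snd v")
    case True
    then have "snd v = snd u + int (nat (snd v - snd u))" "nat (snd v - snd u) \<le> q"
      using * by auto
    then show ?thesis using * unfolding path_step_def by blast
  next
    case False
    then have "snd v = snd u - int (nat (snd u - snd v))" "nat (snd u - snd v) \<le> p"
      "1 \<le> nat (snd u - snd v)"
      using * by auto
    then show ?thesis using * unfolding path_step_def by blast
  qed
qed (auto simp: path_step_def)

text \<open>Splitting off the first vertex mirrors the recursion of \<open>walk_sum\<close>.\<close>

lemma lattice_paths_Suc:
  "lattice_paths p q (Suc l) (s, i) v =
     (\<Union>k\<in>{i - int p..i + int q}. (#) (s, i) ` lattice_paths p q l (s + 1, k) v)"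
proof (rule Set.set_eqI)
  fix \<gamma>
  show "\<gamma> \<in> lattice_paths p q (Suc l) (s, i) v \<longleftrightarrow>
    \<gamma> \<in> (\<Union>k\<in>{i - int p..i + int q}. (#) (s, i) ` lattice_paths p q l (s + 1, k) v)"
  proof (cases \<gamma>)
    case Nil
    then show ?thesis by (auto simp: lattice_paths_def)
  next
    case (Cons u \<delta>)
    have mem: "u # \<delta> \<in> (#) x ` A \<longleftrightarrow> u = x \<and> \<delta> \<in> A" for x A by auto
    show ?thesis
    proof (cases \<delta>)
      case Nil
      then show ?thesis using Cons by (auto simp: lattice_paths_def)
    next
      case (Cons w \<epsilon>)
      then show ?thesis
        unfolding \<open>\<gamma> = u # \<delta>\<close> UN_iff bex_simps mem
        by (cases w) (auto simp: lattice_paths_def path_step_iff All_less_Suc2)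
    qed
  qed
qed

lemma path_weight_Cons:
  assumes "\<gamma> \<noteq> []"
  shows "path_weight a (u # \<gamma>) = step_weight a u (hd \<gamma>) * path_weight a \<gamma>"
proof -
  obtain w \<delta> where "\<gamma> = w # \<delta>" using assms by (cases \<gamma>) auto
  then show ?thesis
    by (simp add: path_weight_def prod.lessThan_Suc_shift del: prod.lessThan_Suc)
qed

lemma finite_lattice_paths: "finite (lattice_paths p q l (s, i) v)"
proof (induction l arbitrary: s i)
  case 0
  have "lattice_paths p q 0 (s, i) v \<subseteq> {[(s, i)]}"
    by (auto simp: lattice_paths_def length_Suc_conv)
  then show ?case by (rule finite_subset) simp
qed (auto simp: lattice_paths_Suc)

text \<open>The initial abscissa \<open>s\<close> is kept general because the tail of a path starts
  one unit further right.\<close>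

lemma sum_path_weight:
  "(\<Sum>\<gamma>\<in>lattice_paths p q l (s, i) (s + l, j). path_weight a \<gamma>) = walk_sum p q a UNIV l i j"
proof (induction l arbitrary: s i)
  case 0
  have "lattice_paths p q 0 (s, i) (s, j) = (if i = j then {[(s, i)]} else {})"
    by (auto simp: lattice_paths_def length_Suc_conv)
  then show ?case by (simp add: path_weight_def)
next
  case (Suc l)
  let ?P = "\<lambda>k. lattice_paths p q l (s + 1, k) (s + Suc l, j)"
  have hd: "\<gamma> \<noteq> []" "hd \<gamma> = (s + 1, k)" if "\<gamma> \<in> ?P k" for \<gamma> k
    using that by (auto simp: lattice_paths_def)
  have "(\<Sum>\<gamma>\<in>lattice_paths p q (Suc l) (s, i) (s + Suc l, j). path_weight a \<gamma>) =
      (\<Sum>k\<in>{i - int p..i + int q}. \<Sum>\<gamma>\<in>(#) (s, i) ` ?P k. path_weight a \<gamma>)"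
    unfolding lattice_paths_Suc
  proof (rule sum.UNION_disjoint)
    show "\<forall>k\<in>{i - int p..i + int q}. \<forall>k'\<in>{i - int p..i + int q}.
      k \<noteq> k' \<longrightarrow> (#) (s, i) ` ?P k \<inter> (#) (s, i) ` ?P k' = {}"
    proof (intro ballI impI)
      fix k k' :: int assume "k \<noteq> k'"
      \<comment> \<open>Paths in the two sets have different first vertices.\<close>
      then have "?P k \<inter> ?P k' = {}" using hd(2)[of _ k] hd(2)[of _ k'] by fastforce
      then show "(#) (s, i) ` ?P k \<inter> (#) (s, i) ` ?P k' = {}" by auto
    qed
  qed (auto simp: finite_lattice_paths)
  also have "\<dots> = (\<Sum>k\<in>{i - int p..i + int q}. \<Sum>\<gamma>\<in>?P k. path_weight a ((s, i) # \<gamma>))"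
    by (simp add: sum.reindex)
  also have "\<dots> = (\<Sum>k\<in>{i - int p..i + int q}. \<Sum>\<gamma>\<in>?P k. a (k - i) (min i k) * path_weight a \<gamma>)"
    \<comment> \<open>Both cases of \<open>step_weight\<close> index the coefficient by the lower
      end of the step, hence the uniform \<open>min i k\<close>.\<close>
    by (intro sum.cong refl) (simp add: path_weight_Cons hd step_weight_def min_def)
  also have "\<dots> = (\<Sum>k\<in>{i - int p..i + int q}. a (k - i) (min i k) * walk_sum p q a UNIV l k j)"
    using Suc[of "s + 1"] by (simp flip: sum_distrib_left)
  finally show ?case by simp
qed

lemma weight_poly_eq_walk_sum: "weight_poly p q a l = walk_sum p q a UNIV l 0 0"
  using sum_path_weight[of a p q l 0 0 0] by (simp add: weight_poly_def)

section \<open>Powers of the banded matrix as confined walk sums\<close>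

lemma banded_matrix_carrier: "banded_matrix p q a n \<in> carrier_mat n n"
  by (simp add: banded_matrix_def)

text \<open>Expanding the product along its first factor chooses the next height; the index range of
  the matrix is what confines walks to \<open>{0..<int n}\<close>, and the band gives the allowed
  steps.\<close>

lemma banded_matrix_pow_eq_walk_sum:
  assumes "i < n" "j < n"
  shows "(banded_matrix p q a n ^\<^sub>m l) $$ (i, j) = walk_sum p q a {0..<int n} l (int i) (int j)"
  using assms
proof (induction l arbitrary: i)
  case 0
  then show ?case using banded_matrix_carrier[of p q a n] by auto
next
  case (Suc l)
  let ?H = "banded_matrix p q a n"
  let ?I = "{int i - int p..int i + int q}"
  have H: "?H \<in> carrier_mat n n" by (rule banded_matrix_carrier)
  have "(?H ^\<^sub>m Suc l) $$ (i, j) = (?H * ?H ^\<^sub>m l) $$ (i, j)"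
    using pow_mat_Suc_left[OF H] by metis
  also have "\<dots> = (\<Sum>r<n. ?H $$ (i, r) * (?H ^\<^sub>m l) $$ (r, j))"
    using H Suc.prems by (intro index_mult_mat_sum) auto
  also have "\<dots> = (\<Sum>r<n. (if int r \<in> ?I then a (int r - int i) (min (int i) (int r)) else 0) *
      walk_sum p q a {0..<int n} l (int r) (int j))"
    using Suc by (intro sum.cong refl) (auto simp: banded_matrix_def of_nat_min)
  also have "\<dots> = (\<Sum>k\<in>{0..<int n}. (if k \<in> ?I then a (k - int i) (min (int i) k) else 0) *
      walk_sum p q a {0..<int n} l k (int j))"
    by (rule sum.reindex_bij_witness[of _ nat int]) auto
  also have "\<dots> = walk_sum p q a {0..<int n} (Suc l) (int i) (int j)"
    by (simp, rule sum.mono_neutral_cong_right) auto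
  finally show ?case .
qed

subsection \<open>Stationarity and averaging\<close>

text \<open>By independence the joint law is a product measure whose factor at \<open>(k, n)\<close>
  is \<open>\<mu> k\<close>, whatever \<open>n\<close> is; it is therefore invariant under
  translation of the second index.\<close>

lemma expectation_shift:
  fixes X :: "int \<Rightarrow> int \<Rightarrow> 'w \<Rightarrow> complex" and F :: "(int \<Rightarrow> int \<Rightarrow> complex) \<Rightarrow> complex"
  assumes M: "prob_space M"
    and rv: "\<And>k n. k \<in> K \<Longrightarrow> X k n \<in> borel_measurable M"
    and dist: "\<And>k n. k \<in> K \<Longrightarrow> distr M borel (X k n) = \<mu> k"
    and indep: "prob_space.indep_vars M (\<lambda>_. borel) (\<lambda>(k, n). X k n) (K \<times> UNIV)"
    and F: "(\<lambda>f. F (\<lambda>k n. f (k, n))) \<in> borel_measurable (\<Pi>\<^sub>M _\<in>K \<times> UNIV. borel)"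
    and F_cong: "\<And>x y. (\<And>k n. k \<in> K \<Longrightarrow> x k n = y k n) \<Longrightarrow> F x = F y"
    and K: "K \<noteq> {}"
  shows "prob_space.expectation M (\<lambda>\<omega>. F (\<lambda>k n. X k (n + s) \<omega>)) =
    prob_space.expectation M (\<lambda>\<omega>. F (\<lambda>k n. X k n \<omega>))"
proof -
  interpret prob_space M by (rule M)
  let ?I = "K \<times> (UNIV :: int set)"
  let ?G = "\<lambda>f. F (\<lambda>k n. f (k, n))"
  let ?B = "\<Pi>\<^sub>M _\<in>?I. (borel :: complex measure)"
  let ?N = "\<Pi>\<^sub>M i\<in>?I. \<mu> (fst i)"
  let ?X = "\<lambda>\<omega>. \<lambda>i\<in>?I. X (fst i) (snd i) \<omega>"
  let ?sh = "\<lambda>i. (fst i, snd i + s)"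
  let ?T = "\<lambda>f. \<lambda>i\<in>?I. f (?sh i)"
  have sets_mu: "sets (\<mu> k) = sets borel" and prob_mu: "prob_space (\<mu> k)" if "k \<in> K" for k
    using dist[OF that, of 0, symmetric] rv[OF that] by (auto intro: prob_space_distr)
  have sets_N: "sets ?N = sets ?B"
    by (intro sets_PiM_cong) (auto simp: sets_mu)
  have X: "?X \<in> measurable M ?B"
    by (intro measurable_restrict) (auto intro: rv)
  have T: "?T \<in> measurable ?B ?B"
    by (intro measurable_restrict) (auto intro!: measurable_component_singleton)
  have T': "?T \<in> measurable ?N ?B"
    using T by (simp only: measurable_cong_sets[OF sets_N refl])
  have "distr M ?B ?X = (\<Pi>\<^sub>M i\<in>?I. distr M borel (X (fst i) (snd i)))"
    using indep K rv
    by (subst (asm) indep_vars_iff_distr_eq_PiM') (auto simp: case_prod_beta)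
  also have "\<dots> = ?N" by (intro PiM_cong) (auto simp: dist)
  finally have D: "distr M ?B ?X = ?N" .
  \<comment> \<open>\<open>?sh\<close> is an injection of \<open>?I\<close> into itself that fixes
    the first component, so the reindexed product has the same factors as \<open>?N\<close>.\<close>
  have "distr ?N (\<Pi>\<^sub>M i\<in>?I. \<mu> (fst (?sh i))) ?T = (\<Pi>\<^sub>M i\<in>?I. \<mu> (fst (?sh i)))"
    by (rule distr_PiM_reindex) (auto simp: inj_on_def prob_mu)
  then have "distr ?N ?N ?T = ?N" by simp
  then have DT: "distr ?N ?B ?T = ?N"
    using distr_cong[of ?N ?N ?N ?B ?T ?T] sets_N by simp
  \<comment> \<open>\<open>?X\<close> and \<open>?T\<close> are \<open>undefined\<close> outside
    \<open>?I\<close>; by \<open>F_cong\<close> the functional \<open>F\<close> does not see those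
    values.\<close>
  have "expectation (\<lambda>\<omega>. F (\<lambda>k n. X k (n + s) \<omega>)) = expectation (\<lambda>\<omega>. ?G (?T (?X \<omega>)))"
    by (intro Bochner_Integration.integral_cong refl F_cong) simp
  also have "\<dots> = (LINT f|distr M ?B ?X. ?G (?T f))"
    by (rule integral_distr[symmetric, OF X measurable_compose[OF T F]])
  also have "\<dots> = (LINT f|distr ?N ?B ?T. ?G f)"
    unfolding D by (rule integral_distr[symmetric, OF T' F])
  also have "\<dots> = (LINT f|distr M ?B ?X. ?G f)"
    unfolding D DT ..
  also have "\<dots> = expectation (\<lambda>\<omega>. ?G (?X \<omega>))"
    by (rule integral_distr[OF X F])
  also have "\<dots> = expectation (\<lambda>\<omega>. F (\<lambda>k n. X k n \<omega>))"
    by (intro Bochner_Integration.integral_cong refl F_cong) simp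
  finally show ?thesis .
qed

text \<open>At most \<open>c + d\<close> indices deviate from \<open>w\<close>, each by at most
  \<open>B\<close>, so the error of the average is of order \<open>1 / n\<close>.\<close>

lemma averages_tendsto:
  fixes e :: "nat \<Rightarrow> nat \<Rightarrow> complex"
  assumes bound: "\<And>n i. i < n \<Longrightarrow> norm (e n i - w) \<le> B"
    and bulk: "\<And>n i. c \<le> i \<Longrightarrow> i + d < n \<Longrightarrow> e n i = w"
  shows "(\<lambda>n. 1 / of_nat n * (\<Sum>i<n. e n i)) \<longlonglongrightarrow> w"
proof -
  have B: "B \<ge> 0" by (rule order_trans[OF norm_ge_zero bound[of 0 1]]) simp
  have est: "norm (1 / of_nat n * (\<Sum>i<n. e n i) - w) \<le> real (c + d) * B / real n"
    if n: "n > 0" for n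
  proof -
    \<comment> \<open>For small \<open>n\<close> the two pieces may overlap, or the truncated
      \<open>n - d\<close> may be 0; the cardinality is only bounded from above.\<close>
    let ?E = "{..<c} \<union> {n - d..<n}"
    have "1 / of_nat n * (\<Sum>i<n. e n i) - w = 1 / of_nat n * (\<Sum>i<n. e n i - w)"
      using n by (simp add: sum_subtractf field_simps)
    then have "norm (1 / of_nat n * (\<Sum>i<n. e n i) - w) = norm (\<Sum>i<n. e n i - w) / real n"
      by (simp add: norm_mult norm_divide)
    also have "norm (\<Sum>i<n. e n i - w) \<le> (\<Sum>i<n. norm (e n i - w))"
      by (rule norm_sum)
    also have "\<dots> \<le> (\<Sum>i<n. if i \<in> ?E then B else 0)"
      using bound bulk by (intro sum_mono) auto
    also have "\<dots> = real (card ({..<n} \<inter> ?E)) * B"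
      by (subst sum.inter_restrict[symmetric]) simp_all
    also have "\<dots> \<le> real (c + d) * B"
    proof (rule mult_right_mono[OF _ B])
      have "card ({..<n} \<inter> ?E) \<le> card ?E" by (rule card_mono) auto
      also have "\<dots> \<le> card {..<c} + card {n - d..<n}" by (rule card_Un_le)
      also have "\<dots> \<le> c + d" by simp
      finally show "real (card ({..<n} \<inter> ?E)) \<le> real (c + d)" by simp
    qed
    finally show ?thesis using n by (simp add: divide_right_mono)
  qed
  have "(\<lambda>n. 1 / of_nat n * (\<Sum>i<n. e n i) - w) \<longlonglongrightarrow> 0"
  proof (rule Lim_null_comparison)
    show "\<forall>\<^sub>F n in sequentially. norm (1 / of_nat n * (\<Sum>i<n. e n i) - w) \<le> real (c + d) * B / real n"
      using eventually_gt_at_top[of 0] by eventually_elim (rule est)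
    show "(\<lambda>n. real (c + d) * B / real n) \<longlonglongrightarrow> 0"
      by (rule lim_const_over_n)
  qed
  then show ?thesis by (simp add: LIM_zero_iff)
qed

section \<open>Convergence of the expected moments\<close>

theorem theorem8p1:
  fixes p q :: nat
    and M :: "'w measure"
    and \<mu> :: "int \<Rightarrow> complex measure"
    and a :: "int \<Rightarrow> int \<Rightarrow> 'w \<Rightarrow> complex"
  assumes "p \<ge> 1" and "q \<ge> 1"
    and "prob_space M"
    and "\<And>k. k \<in> {- int p..int q} \<Longrightarrow> prob_space (\<mu> k)"
    and "\<And>k. k \<in> {- int p..int q} \<Longrightarrow> sets (\<mu> k) = sets borel"
    and "\<And>k. k \<in> {- int p..int q} \<Longrightarrow> compact (measure_support (\<mu> k))"
    and "\<And>k n. k \<in> {- int p..int q} \<Longrightarrow> a k n \<in> borel_measurable M"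
    and "\<And>k n. k \<in> {- int p..int q} \<Longrightarrow> distr M borel (a k n) = \<mu> k"
    and "prob_space.indep_vars M (\<lambda>_. borel) (\<lambda>(k, n). a k n) ({- int p..int q} \<times> UNIV)"
    and "\<exists>C::real. \<forall>k\<in>{- int p..int q}. \<forall>n. \<forall>\<omega>\<in>space M. norm (a k n \<omega>) \<le> C"
  shows "\<forall>l::nat.
    (\<lambda>n. prob_space.expectation M (\<lambda>\<omega>.
        LINT z|empirical_measure (banded_matrix p q (\<lambda>k m. a k m \<omega>) n). z ^ l))
      \<longlonglongrightarrow> prob_space.expectation M (\<lambda>\<omega>. weight_poly p q (\<lambda>k m. a k m \<omega>) l) \<and>
    (\<lambda>n. prob_space.expectation M (\<lambda>\<omega>.
        1 / of_nat n *
        (\<Sum>x\<in>#eigenvalue_mset (banded_matrix p q (\<lambda>k m. a k m \<omega>) n). x ^ l)))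
      \<longlonglongrightarrow> prob_space.expectation M (\<lambda>\<omega>. weight_poly p q (\<lambda>k m. a k m \<omega>) l)"
proof
  fix l :: nat
  interpret prob_space M by (rule assms(3))
  let ?H = "\<lambda>n \<omega>. banded_matrix p q (\<lambda>k m. a k m \<omega>) n"
  \<comment> \<open>Closed walks at height \<open>i\<close>: \<open>S = {0..<int n}\<close> gives a
    diagonal entry of the matrix power, and \<open>S = UNIV\<close> with \<open>i = 0\<close> the
    weight polynomial.\<close>
  define V where "V S i \<omega> = walk_sum p q (\<lambda>k m. a k m \<omega>) S l i i" for S i \<omega>
  obtain C0 where C0: "\<And>k n \<omega>. k \<in> {- int p..int q} \<Longrightarrow> \<omega> \<in> space M \<Longrightarrow> norm (a k n \<omega>) \<le> C0"
    using assms(10) by blast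
  \<comment> \<open>\<open>norm_walk_sum_le\<close> asks for a nonnegative bound.\<close>
  define C where "C = max C0 0"
  have C: "norm (a k n \<omega>) \<le> C" if "k \<in> {- int p..int q}" "\<omega> \<in> space M" for k n \<omega>
    using C0[OF that] by (simp add: C_def le_max_iff_disj)
  define B where "B = (real (p + q + 1) * C) ^ l"
  have V_bound: "norm (V S i \<omega>) \<le> B" if "\<omega> \<in> space M" for S i \<omega>
    unfolding V_def B_def using that by (intro norm_walk_sum_le C) (auto simp: C_def)
  have V_measurable: "V S i \<in> borel_measurable M" for S i
    unfolding V_def by (intro walk_sum_measurable assms(7))
  have V_integrable: "integrable M (V S i)" for S i
    using V_bound V_measurable by (intro integrable_const_bound[of _ B]) auto
  have EV_bound: "norm (expectation (V S i)) \<le> B" for S i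
  proof -
    have "norm (expectation (V S i)) \<le> expectation (\<lambda>\<omega>. norm (V S i \<omega>))"
      by (rule integral_norm_bound)
    also have "\<dots> \<le> expectation (\<lambda>_. B)"
      using V_integrable V_bound by (intro integral_mono) auto
    finally show ?thesis by (simp add: prob_space)
  qed
  have EV_shift: "expectation (V UNIV i) = expectation (V UNIV 0)" for i
  proof -
    let ?F = "\<lambda>x. walk_sum p q x UNIV l 0 0"
    have "expectation (\<lambda>\<omega>. ?F (\<lambda>k n. a k (n + i) \<omega>)) = expectation (\<lambda>\<omega>. ?F (\<lambda>k n. a k n \<omega>))"
    proof (rule expectation_shift[where K = "{- int p..int q}" and \<mu> = \<mu>])
      show "(\<lambda>f. ?F (\<lambda>k n. f (k, n))) \<in> borel_measurable (\<Pi>\<^sub>M _\<in>{- int p..int q} \<times> UNIV. borel)"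
        by (intro walk_sum_measurable measurable_component_singleton) auto
      show "?F x = ?F y" if "\<And>k n. k \<in> {- int p..int q} \<Longrightarrow> x k n = y k n" for x y
        using that by (rule walk_sum_cong)
    qed (rule assms(3) assms(7) assms(8) assms(9) | simp)+
    then show ?thesis
      unfolding V_def by (simp add: walk_sum_shift[of p q "\<lambda>k n. a k n _"])
  qed
  have trace: "(\<Sum>x\<in>#eigenvalue_mset (?H n \<omega>). x ^ l) = (\<Sum>i<n. V {0..<int n} (int i) \<omega>)" for n \<omega>
    by (simp add: sum_eigenvalue_powers[OF banded_matrix_carrier] banded_matrix_pow_eq_walk_sum V_def)
  have "(\<lambda>n. 1 / of_nat n * (\<Sum>i<n. expectation (V {0..<int n} (int i)))) \<longlonglongrightarrow> expectation (V UNIV 0)"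
  \<comment> \<open>The margins are the greatest descent and climb in \<open>l\<close> steps;
    \<open>2 * B\<close> bounds the difference of two expectations of norm at most
    \<open>B\<close>.\<close>
  proof (rule averages_tendsto[where c = "p * l" and d = "q * l" and B = "2 * B"])
    show "norm (expectation (V {0..<int n} (int i)) - expectation (V UNIV 0)) \<le> 2 * B" for n i
      using norm_triangle_ineq4[of "expectation (V {0..<int n} (int i))" "expectation (V UNIV 0)"]
        EV_bound[of "{0..<int n}" "int i"] EV_bound[of UNIV 0] by linarith
    show "expectation (V {0..<int n} (int i)) = expectation (V UNIV 0)"
      if "p * l \<le> i" "i + q * l < n" for n i
    proof -
      have "int (p * l) \<le> int i" "int i + int (q * l) < int n"
        using that by linarith+
      then have "{int i - int (p * l)..int i + int (q * l)} \<subseteq> {0..<int n}"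
        by (intro subsetI) (simp only: atLeastAtMost_iff atLeastLessThan_iff, linarith)
      then have "V {0..<int n} (int i) = V UNIV (int i)"
        unfolding V_def by (intro ext walk_sum_interior)
      then show ?thesis using EV_shift[of "int i"] by simp
    qed
  qed
  moreover have "expectation (\<lambda>\<omega>. 1 / of_nat n * (\<Sum>x\<in>#eigenvalue_mset (?H n \<omega>). x ^ l)) =
      1 / of_nat n * (\<Sum>i<n. expectation (V {0..<int n} (int i)))" for n
    unfolding trace by (simp only: integral_mult_right_zero Bochner_Integration.integral_sum[OF V_integrable])
  ultimately have *: "(\<lambda>n. expectation (\<lambda>\<omega>. 1 / of_nat n * (\<Sum>x\<in>#eigenvalue_mset (?H n \<omega>). x ^ l)))
      \<longlonglongrightarrow> expectation (\<lambda>\<omega>. weight_poly p q (\<lambda>k m. a k m \<omega>) l)"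
    by (simp add: V_def[abs_def] weight_poly_eq_walk_sum)
  \<comment> \<open>The integral formula is available only for \<open>n > 0\<close>, so the two
    sequences are compared eventually.\<close>
  have ev: "\<forall>\<^sub>F n in sequentially. expectation (\<lambda>\<omega>. LINT z|empirical_measure (?H n \<omega>). z ^ l) =
      expectation (\<lambda>\<omega>. 1 / of_nat n * (\<Sum>x\<in>#eigenvalue_mset (?H n \<omega>). x ^ l))"
    using eventually_gt_at_top[of 0]
  proof eventually_elim
    case (elim n)
    have "(LINT z|empirical_measure (?H n \<omega>). z ^ l) =
        1 / of_nat n * (\<Sum>x\<in>#eigenvalue_mset (?H n \<omega>). x ^ l)" for \<omega>
      by (rule integral_empirical_measure[OF banded_matrix_carrier elim]) simp
    then show ?case by simp
  qed
  from * tendsto_cong[OF ev] show "(\<lambda>n. expectation (\<lambda>\<omega>. LINT z|empirical_measure (?H n \<omega>). z ^ l))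
      \<longlonglongrightarrow> expectation (\<lambda>\<omega>. weight_poly p q (\<lambda>k m. a k m \<omega>) l) \<and>
    (\<lambda>n. expectation (\<lambda>\<omega>. 1 / of_nat n * (\<Sum>x\<in>#eigenvalue_mset (?H n \<omega>). x ^ l)))
      \<longlonglongrightarrow> expectation (\<lambda>\<omega>. weight_poly p q (\<lambda>k m. a k m \<omega>) l)"
    by blast
qed

end
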